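(* For every integer $d>2$, the logic ${\cal R}ing(0,+,* )$ is strictly less expressive than ${\cal R}ing(0,+,* )+MOD(d)$: every sentence of ${\cal R}ing(0,+,* )$ is a sentence of ${\cal R}ing(0,+,* )+MOD(d)$, and there is a sentence $\theta$ of ${\cal R}ing(0,+,* )+MOD(d)$ such that no sentence $\sigma$ of ${\cal R}ing(0,+,* )$ satisfies $\mathbb{Z}_m\models\sigma \iff \mathbb{Z}_m\models\theta$ for all integers $m\ge1$.
   Context: For an integer $m\ge 1$, $\mathbb{Z}_m$ is the finite residue class ring with universe $\{0,\ldots,m-1\}$ and addition and multiplication mod $m$. ${\cal R}ing(0,+,* )$ is the set of first-order formulas over a constant symbol $0$ and binary function symbols $+,*$, interpreted in $\mathbb{Z}_m$ as the residue class $0$ and addition and multiplication mod $m$. ${\cal R}ing(0,+,* )+MOD(d)$ is its extension closed additionally under the modular quantifiers $\exists^{(r,d)}z$ for $0\le r<d$, where $\mathbb{Z}_m\models\exists^{(r,d)}z\,\phi(\bar a,z)$ iff the number of $z\in\mathbb{Z}_m$ satisfying $\phi(\bar a,z)$ is congruent to $r$ modulo $d$. *)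

theory Defs
  imports "HOL-Number_Theory.Number_Theory"
begin

datatype tm =
    Var nat
  | Zero
  | Add tm tm
  | Mul tm tm

text \<open>The quantifier \<open>ExMod r d z \<phi>\<close> is \<open>\<exists>\<^sup>(\<^sup>r\<^sup>,\<^sup>d\<^sup>) z. \<phi>\<close>. The type admits arbitrary \<open>r\<close> and \<open>d\<close>,
  and different moduli in one formula; the logics proper are the two inductive sets below.\<close>

datatype fm =
    Eq tm tm
  | Neg fm
  | Conj fm fm
  | Disj fm fm
  | Ex nat fm
  | All nat fm
  | ExMod nat nat nat fm

inductive_set Ring_formulas :: "fm set" where
  "Eq s t \<in> Ring_formulas"
| "\<phi> \<in> Ring_formulas \<Longrightarrow> Neg \<phi> \<in> Ring_formulas"
| "\<phi> \<in> Ring_formulas \<Longrightarrow> \<psi> \<in> Ring_formulas \<Longrightarrow> Conj \<phi> \<psi> \<in> Ring_formulas"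
| "\<phi> \<in> Ring_formulas \<Longrightarrow> \<psi> \<in> Ring_formulas \<Longrightarrow> Disj \<phi> \<psi> \<in> Ring_formulas"
| "\<phi> \<in> Ring_formulas \<Longrightarrow> Ex z \<phi> \<in> Ring_formulas"
| "\<phi> \<in> Ring_formulas \<Longrightarrow> All z \<phi> \<in> Ring_formulas"

inductive_set Ring_MOD_formulas :: "nat \<Rightarrow> fm set" for d :: nat where
  "Eq s t \<in> Ring_MOD_formulas d"
| "\<phi> \<in> Ring_MOD_formulas d \<Longrightarrow> Neg \<phi> \<in> Ring_MOD_formulas d"
| "\<phi> \<in> Ring_MOD_formulas d \<Longrightarrow> \<psi> \<in> Ring_MOD_formulas d \<Longrightarrow> Conj \<phi> \<psi> \<in> Ring_MOD_formulas d"
| "\<phi> \<in> Ring_MOD_formulas d \<Longrightarrow> \<psi> \<in> Ring_MOD_formulas d \<Longrightarrow> Disj \<phi> \<psi> \<in> Ring_MOD_formulas d"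
| "\<phi> \<in> Ring_MOD_formulas d \<Longrightarrow> Ex z \<phi> \<in> Ring_MOD_formulas d"
| "\<phi> \<in> Ring_MOD_formulas d \<Longrightarrow> All z \<phi> \<in> Ring_MOD_formulas d"
| "\<phi> \<in> Ring_MOD_formulas d \<Longrightarrow> r < d \<Longrightarrow> ExMod r d z \<phi> \<in> Ring_MOD_formulas d"

primrec tm_vars :: "tm \<Rightarrow> nat set" where
  "tm_vars (Var n) = {n}"
| "tm_vars Zero = {}"
| "tm_vars (Add s t) = tm_vars s \<union> tm_vars t"
| "tm_vars (Mul s t) = tm_vars s \<union> tm_vars t"

primrec free_vars :: "fm \<Rightarrow> nat set" where
  "free_vars (Eq s t) = tm_vars s \<union> tm_vars t"
| "free_vars (Neg \<phi>) = free_vars \<phi>"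
| "free_vars (Conj \<phi> \<psi>) = free_vars \<phi> \<union> free_vars \<psi>"
| "free_vars (Disj \<phi> \<psi>) = free_vars \<phi> \<union> free_vars \<psi>"
| "free_vars (Ex z \<phi>) = free_vars \<phi> - {z}"
| "free_vars (All z \<phi>) = free_vars \<phi> - {z}"
| "free_vars (ExMod r d z \<phi>) = free_vars \<phi> - {z}"

definition Ring_sentences :: "fm set" where
  "Ring_sentences = {\<phi> \<in> Ring_formulas. free_vars \<phi> = {}}"

definition Ring_MOD_sentences :: "nat \<Rightarrow> fm set" where
  "Ring_MOD_sentences d = {\<phi> \<in> Ring_MOD_formulas d. free_vars \<phi> = {}}"

primrec tm_val :: "('a, 'b) ring_scheme \<Rightarrow> (nat \<Rightarrow> 'a) \<Rightarrow> tm \<Rightarrow> 'a" where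
  "tm_val R e (Var n) = e n"
| "tm_val R e Zero = \<zero>\<^bsub>R\<^esub>"
| "tm_val R e (Add s t) = tm_val R e s \<oplus>\<^bsub>R\<^esub> tm_val R e t"
| "tm_val R e (Mul s t) = tm_val R e s \<otimes>\<^bsub>R\<^esub> tm_val R e t"

primrec sat :: "('a, 'b) ring_scheme \<Rightarrow> (nat \<Rightarrow> 'a) \<Rightarrow> fm \<Rightarrow> bool" where
  "sat R e (Eq s t) \<longleftrightarrow> tm_val R e s = tm_val R e t"
| "sat R e (Neg \<phi>) \<longleftrightarrow> \<not> sat R e \<phi>"
| "sat R e (Conj \<phi> \<psi>) \<longleftrightarrow> sat R e \<phi> \<and> sat R e \<psi>"
| "sat R e (Disj \<phi> \<psi>) \<longleftrightarrow> sat R e \<phi> \<or> sat R e \<psi>"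
| "sat R e (Ex z \<phi>) \<longleftrightarrow> (\<exists>a \<in> carrier R. sat R (e(z := a)) \<phi>)"
| "sat R e (All z \<phi>) \<longleftrightarrow> (\<forall>a \<in> carrier R. sat R (e(z := a)) \<phi>)"
| "sat R e (ExMod r d z \<phi>) \<longleftrightarrow> [card {a \<in> carrier R. sat R (e(z := a)) \<phi>} = r] (mod d)"

definition models :: "('a, 'b) ring_scheme \<Rightarrow> fm \<Rightarrow> bool" (infix "\<TTurnstile>" 50) where
  "R \<TTurnstile> \<phi> \<longleftrightarrow> (\<forall>e. range e \<subseteq> carrier R \<longrightarrow> sat R e \<phi>)"

text \<open>\<open>residue_ring m\<close> has carrier \<open>{0..m - 1}\<close> with addition and multiplication mod \<open>m\<close>.
  Its \<open>one\<close> is \<open>1\<close> even for \<open>m = 1\<close>, where \<open>1\<close> lies outside the carrier; this is harmless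
  because the language has no symbol for \<open>1\<close>, so \<open>m = 1\<close> gives the intended trivial ring.\<close>

abbreviation Zmod :: "nat \<Rightarrow> int ring" where
  "Zmod m \<equiv> residue_ring (int m)"

end

theory Submission
  imports Defs "HOL-Library.Nat_Bijection" "HOL-Library.FuncSet"
begin

text \<open>
  The separating sentence says \<open>m \<equiv> 1 (mod d)\<close>. There are infinitely many pairwise coprime
  moduli congruent to \<open>-1\<close> mod \<open>d\<close>; a product of \<open>N\<close> of them is \<open>(-1)^N\<close> mod \<open>d\<close>, so for
  \<open>d > 2\<close> the sentence detects the parity of \<open>N\<close>. A first-order sentence does not: by the Chinese
  remainder theorem \<open>\<int>\<^sub>m\<close> is the product of the factor rings, by pigeonhole we may take the
  factors to be indistinguishable by the sentence, and an Ehrenfeucht-Fraisse argument shows that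
  deleting one factor out of sufficiently many indistinguishable ones changes nothing.
\<close>

section \<open>Strategy types and their finiteness\<close>

text \<open>Terms are evaluated over the integers and reduced only when an equation is tested, so
  that one environment serves all moduli at once.\<close>

primrec int_val :: "(nat \<Rightarrow> int) \<Rightarrow> tm \<Rightarrow> int" where
  "int_val e (Var n) = e n"
| "int_val e Zero = 0"
| "int_val e (Add s t) = int_val e s + int_val e t"
| "int_val e (Mul s t) = int_val e s * int_val e t"

text \<open>The strategy type records the outcome of all plays in which quantifiers are replaced by moves;
  two equal types mean a back-and-forth along \<open>\<phi>\<close>. Moves range over all integers, which stand for
  their residues mod \<open>m\<close>. Coding types as numbers keeps them in one HOL type.
  The clause for \<^const>\<open>ExMod\<close> is a dummy.\<close>

primrec strategy_type :: "fm \<Rightarrow> int \<Rightarrow> (nat \<Rightarrow> int) \<Rightarrow> nat" where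
  "strategy_type (Eq s t) m e = of_bool [int_val e s = int_val e t] (mod m)"
| "strategy_type (Neg \<phi>) m e = strategy_type \<phi> m e"
| "strategy_type (Conj \<phi> \<psi>) m e = prod_encode (strategy_type \<phi> m e, strategy_type \<psi> m e)"
| "strategy_type (Disj \<phi> \<psi>) m e = prod_encode (strategy_type \<phi> m e, strategy_type \<psi> m e)"
| "strategy_type (Ex z \<phi>) m e = set_encode (range (\<lambda>a. strategy_type \<phi> m (e(z := a))))"
| "strategy_type (All z \<phi>) m e = set_encode (range (\<lambda>a. strategy_type \<phi> m (e(z := a))))"
| "strategy_type (ExMod r d z \<phi>) m e = 0"

definition types_of :: "fm \<Rightarrow> nat set" where
  "types_of \<phi> = range (\<lambda>(m, e). strategy_type \<phi> m e)"

lemma strategy_type_in_types_of [simp]: "strategy_type \<phi> m e \<in> types_of \<phi>"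
  unfolding types_of_def by (metis case_prod_conv rangeI)

text \<open>\<open>Neg \<phi>\<close>, \<open>Disj \<phi> \<psi>\<close> and \<open>All z \<phi>\<close> have the same strategy types as \<open>\<phi>\<close>, \<open>Conj \<phi> \<psi>\<close> and
  \<open>Ex z \<phi>\<close>, so inductions about strategy types may skip them.\<close>

lemma strategy_induct [case_names Eq Conj Ex ExMod equal]:
  assumes "\<And>s t. P (Eq s t)"
    and "\<And>\<phi> \<psi>. P \<phi> \<Longrightarrow> P \<psi> \<Longrightarrow> P (Conj \<phi> \<psi>)"
    and "\<And>z \<phi>. P \<phi> \<Longrightarrow> P (Ex z \<phi>)"
    and "\<And>r d z \<phi>. P (ExMod r d z \<phi>)"
    and equal: "\<And>\<phi> \<psi>. strategy_type \<psi> = strategy_type \<phi> \<Longrightarrow> P \<phi> \<Longrightarrow> P \<psi>"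
  shows "P \<phi>"
proof (induction \<phi> rule: fm.induct)
  case (Neg \<phi>)
  then show ?case
    by (rule equal[rotated]) (intro ext, simp)
next
  case (Disj \<phi> \<psi>)
  show ?case
    by (rule equal[of _ "Conj \<phi> \<psi>"]) (intro ext, simp, intro assms(2) Disj)
next
  case (All z \<phi>)
  show ?case
    by (rule equal[of _ "Ex z \<phi>"]) (intro ext, simp, intro assms(3) All)
qed (use assms in blast)+

text \<open>An equation has two types, and every other clause combines finitely many earlier ones or
  is constant. The bound depends on the formula alone, uniformly in modulus and environment, and all
  pigeonhole arguments rest on this.\<close>

lemma finite_types_of [simp]: "finite (types_of \<phi>)"
proof (induction \<phi> rule: strategy_induct)
  case (Eq s t)
  have "types_of (Eq s t) \<subseteq> {0, 1}"
    by (auto simp: types_of_def)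
  then show ?case
    by (rule finite_subset) simp
next
  case (Conj \<phi> \<psi>)
  have "types_of (Conj \<phi> \<psi>) \<subseteq> prod_encode ` (types_of \<phi> \<times> types_of \<psi>)"
    by (subst types_of_def) auto
  then show ?case
    by (rule finite_subset) (use Conj in simp)
next
  case (Ex z \<phi>)
  have "types_of (Ex z \<phi>) \<subseteq> set_encode ` Pow (types_of \<phi>)"
    by (subst types_of_def) auto
  then show ?case
    by (rule finite_subset) (use Ex in simp)
next
  case (ExMod r d z \<phi>)
  have "types_of (ExMod r d z \<phi>) \<subseteq> {0}"
    by (auto simp: types_of_def)
  then show ?case
    by (rule finite_subset) simp
next
  case (equal \<phi> \<psi>)
  then show ?case
    by (simp add: types_of_def)
qed

lemma strategy_type_Ex_eq_iff:
  "strategy_type (Ex z \<phi>) m e = strategy_type (Ex z \<phi>) m' e' \<longleftrightarrow>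
    range (\<lambda>a. strategy_type \<phi> m (e(z := a))) = range (\<lambda>a. strategy_type \<phi> m' (e'(z := a)))"
proof -
  \<comment> \<open>\<open>set_encode\<close> is injective only on finite sets. The moves range over
    all integers, but their types form a finite set.\<close>
  have "finite (range (\<lambda>a. strategy_type \<phi> m (e(z := a))))" for m e
    by (rule finite_subset[OF _ finite_types_of[of \<phi>]]) auto
  then show ?thesis
    by (simp add: set_encode_eq)
qed

text \<open>The assumptions are the forth and back conditions of one round of the game.\<close>

lemma strategy_type_Ex_eqI:
  assumes "\<And>a. \<exists>b. strategy_type \<phi> m (e(z := a)) = strategy_type \<phi> m' (e'(z := b))"
    and "\<And>b. \<exists>a. strategy_type \<phi> m (e(z := a)) = strategy_type \<phi> m' (e'(z := b))"
  shows "strategy_type (Ex z \<phi>) m e = strategy_type (Ex z \<phi>) m' e'"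
  unfolding strategy_type_Ex_eq_iff
proof (intro equalityI subsetI)
  fix t assume "t \<in> range (\<lambda>a. strategy_type \<phi> m (e(z := a)))"
  then show "t \<in> range (\<lambda>a. strategy_type \<phi> m' (e'(z := a)))"
    using assms(1) by auto
next
  fix t assume "t \<in> range (\<lambda>a. strategy_type \<phi> m' (e'(z := a)))"
  then show "t \<in> range (\<lambda>a. strategy_type \<phi> m (e(z := a)))"
    using assms(2) by (metis (no_types, lifting) imageE rangeI)
qed

lemma strategy_type_Ex_eqE:
  assumes "strategy_type (Ex z \<phi>) m e = strategy_type (Ex z \<phi>) m' e'"
  obtains b where "strategy_type \<phi> m (e(z := a)) = strategy_type \<phi> m' (e'(z := b))"
proof -
  have "strategy_type \<phi> m (e(z := a)) \<in> range (\<lambda>b. strategy_type \<phi> m' (e'(z := b)))"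
    using assms unfolding strategy_type_Ex_eq_iff by blast
  then show thesis
    using that by blast
qed

section \<open>Congruent environments and coprime products\<close>

lemma int_val_cong:
  assumes "\<And>n. [e n = e' n] (mod m)"
  shows "[int_val e t = int_val e' t] (mod m)"
  by (induction t) (auto intro: assms cong_add cong_mult)

text \<open>Equations see only residues, and a move overwrites both environments alike. This allows
  replacing a move by any solution of simultaneous congruences.\<close>

lemma strategy_type_cong:
  assumes "\<And>n. [e n = e' n] (mod m)"
  shows "strategy_type \<phi> m e = strategy_type \<phi> m e'"
  using assms
proof (induction \<phi> arbitrary: e e' rule: strategy_induct)
  case (Eq s t)
  have "[int_val e s = int_val e t] (mod m) \<longleftrightarrow> [int_val e' s = int_val e' t] (mod m)"
    using int_val_cong[OF Eq, where t = s] int_val_cong[OF Eq, where t = t] by (simp add: cong_def)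
  then show ?case
    by simp
next
  case (Conj \<phi> \<psi>)
  then show ?case
    by (metis strategy_type.simps(3))
next
  case (Ex z \<phi>)
  have "strategy_type \<phi> m (e(z := a)) = strategy_type \<phi> m (e'(z := a))" for a
    by (rule Ex.IH) (simp add: Ex.prems)
  then show ?case
    by simp
next
  case (equal \<phi> \<psi>)
  then show ?case
    by metis
qed simp

lemma strategy_type_update_cong:
  assumes "[a = b] (mod m)"
  shows "strategy_type \<phi> m (e(z := a)) = strategy_type \<phi> m (e(z := b))"
  by (rule strategy_type_cong) (simp add: assms)

lemma cong_mult_coprime_iff:
  fixes x y k i :: int
  assumes "coprime k i"
  shows "[x = y] (mod k * i) \<longleftrightarrow> [x = y] (mod k) \<and> [x = y] (mod i)"
  using assms coprime_cong_mult[of x y k i] cong_modulus_mult[of x y k i] cong_modulus_mult[of x y i k]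
  by (auto simp: mult.commute)

text \<open>A Feferman-Vaught argument: a move in the product is answered in each factor separately,
  and the Chinese remainder theorem merges the two answers into a single integer.\<close>

lemma strategy_type_mult:
  assumes "coprime k i" "coprime k' i'"
    and "strategy_type \<phi> k e = strategy_type \<phi> k' e'"
    and "strategy_type \<phi> i e = strategy_type \<phi> i' e'"
  shows "strategy_type \<phi> (k * i) e = strategy_type \<phi> (k' * i') e'"
  using assms
proof (induction \<phi> arbitrary: k i k' i' e e' rule: strategy_induct)
  case (Eq s t)
  then show ?case
    by (simp add: cong_mult_coprime_iff of_bool_eq_iff)
next
  case (Conj \<phi> \<psi>)
  have "strategy_type \<phi> k e = strategy_type \<phi> k' e'" "strategy_type \<psi> k e = strategy_type \<psi> k' e'"
    "strategy_type \<phi> i e = strategy_type \<phi> i' e'" "strategy_type \<psi> i e = strategy_type \<psi> i' e'"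
    using Conj.prems by simp_all
  then have "strategy_type \<phi> (k * i) e = strategy_type \<phi> (k' * i') e'"
    "strategy_type \<psi> (k * i) e = strategy_type \<psi> (k' * i') e'"
    using Conj.prems(1,2) by (blast intro: Conj.IH)+
  then show ?case
    by simp
next
  case (Ex z \<phi>)
  have move: "\<exists>b. strategy_type \<phi> (k * i) (e(z := a)) = strategy_type \<phi> (k' * i') (e'(z := b))"
    if coprime: "coprime k i" "coprime k' i'"
      and k: "strategy_type (Ex z \<phi>) k e = strategy_type (Ex z \<phi>) k' e'"
      and i: "strategy_type (Ex z \<phi>) i e = strategy_type (Ex z \<phi>) i' e'"
    for k i k' i' e e' a
  proof -
    obtain b1 where b1: "strategy_type \<phi> k (e(z := a)) = strategy_type \<phi> k' (e'(z := b1))"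
      by (rule strategy_type_Ex_eqE[OF k])
    obtain b2 where b2: "strategy_type \<phi> i (e(z := a)) = strategy_type \<phi> i' (e'(z := b2))"
      by (rule strategy_type_Ex_eqE[OF i])
    obtain b where b: "[b = b1] (mod k')" "[b = b2] (mod i')"
      using binary_chinese_remainder_int[OF coprime(2)] by blast
    have "strategy_type \<phi> (k * i) (e(z := a)) = strategy_type \<phi> (k' * i') (e'(z := b))"
      by (intro Ex.IH coprime)
        (simp_all only: b1 b2 strategy_type_update_cong[OF b(1)] strategy_type_update_cong[OF b(2)])
    then show ?thesis ..
  qed
  show ?case
  proof (rule strategy_type_Ex_eqI)
    show "\<exists>b. strategy_type \<phi> (k * i) (e(z := a)) = strategy_type \<phi> (k' * i') (e'(z := b))" for a
      using Ex.prems by (rule move)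
    have "\<exists>a. strategy_type \<phi> (k' * i') (e'(z := b)) = strategy_type \<phi> (k * i) (e(z := a))" for b
      by (rule move) (use Ex.prems in \<open>simp_all only:\<close>)
    then show "\<exists>a. strategy_type \<phi> (k * i) (e(z := a)) = strategy_type \<phi> (k' * i') (e'(z := b))" for b
      by (simp only: eq_commute)
  qed
next
  case (equal \<phi> \<psi>)
  then show ?case
    by metis
qed simp

section \<open>Deleting one of many equal factors\<close>

lemma pigeonhole_types:
  assumes "finite D" "K * card (types_of \<phi>) < card D"
  obtains D' where "D' \<subseteq> D" "K < card D'"
    "\<And>i j. i \<in> D' \<Longrightarrow> j \<in> D' \<Longrightarrow> strategy_type \<phi> i e = strategy_type \<phi> j e"
proof -
  let ?f = "\<lambda>i. strategy_type \<phi> i e"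
  obtain t where t: "card D \<le> card (?f -` {t} \<inter> D) * card (types_of \<phi>)"
    using pigeonhole_card[of ?f D "types_of \<phi>"] assms(1) strategy_type_in_types_of[of \<phi>]
    by fastforce
  show thesis
  proof
    show "?f -` {t} \<inter> D \<subseteq> D"
      by blast
    show "K < card (?f -` {t} \<inter> D)"
      using t assms(2) by (metis less_le_trans mult_less_cancel2)
  qed auto
qed

text \<open>\<open>K\<close> is a threshold for the class \<open>D\<close> of factors equal to
  \<open>j\<close>. The factors in \<open>J - D\<close> are arbitrary because a move splits
  \<open>D\<close> into smaller classes, and the induction continues with just one of them.\<close>

definition deletable :: "fm \<Rightarrow> nat \<Rightarrow> bool" where
  "deletable \<phi> K \<longleftrightarrow> (\<forall>J D j e. finite J \<longrightarrow> pairwise coprime J \<longrightarrow> D \<subseteq> J \<longrightarrow> K < card D \<longrightarrow> j \<in> D \<longrightarrow>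
    (\<forall>i\<in>D. strategy_type \<phi> i e = strategy_type \<phi> j e) \<longrightarrow>
    strategy_type \<phi> (\<Prod>J) e = strategy_type \<phi> (\<Prod>(J - {j})) e)"

lemma deletableD:
  assumes "deletable \<phi> K" "finite J" "pairwise coprime J" "D \<subseteq> J" "K < card D" "j \<in> D"
    and "\<And>i. i \<in> D \<Longrightarrow> strategy_type \<phi> i e = strategy_type \<phi> j e"
  shows "strategy_type \<phi> (\<Prod>J) e = strategy_type \<phi> (\<Prod>(J - {j})) e"
  using assms unfolding deletable_def by blast

lemma deletable_mono: "deletable \<phi> K \<Longrightarrow> K \<le> K' \<Longrightarrow> deletable \<phi> K'"
  unfolding deletable_def using le_less_trans by blast

lemma coprime_prod_Diff:
  fixes J :: "int set"
  assumes "pairwise coprime J" "j \<in> J" "I \<subseteq> J" "j \<notin> I"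
  shows "coprime (\<Prod>I) j"
proof (rule prod_coprime_left)
  show "coprime i j" if "i \<in> I" for i
    using assms that by (metis pairwiseD subsetD)
qed

text \<open>Threshold 1 provides a second factor \<open>i\<close> in \<open>D\<close>. An equation
  valid modulo the product without \<open>j\<close> is valid mod \<open>i\<close>, hence mod
  \<open>j\<close> by equality of types, hence modulo the full product.\<close>

lemma deletable_Eq: "deletable (Eq s t) 1"
  unfolding deletable_def
proof (intro allI impI)
  fix J D :: "int set" and j e
  assume J: "finite J" "pairwise coprime J" and D: "D \<subseteq> J" "1 < card D" and j: "j \<in> D"
    and same: "\<forall>i\<in>D. strategy_type (Eq s t) i e = strategy_type (Eq s t) j e"
  obtain i where i: "i \<in> D" "i \<noteq> j"
    using D j by (metis One_nat_def card.infinite card_le_Suc0_iff_eq not_le not_less_zero)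
  have "i dvd \<Prod>(J - {j})"
    using i D J by (intro dvd_prodI[of _ _ "\<lambda>x. x"]) auto
  then have "[int_val e s = int_val e t] (mod j)" if "[int_val e s = int_val e t] (mod \<Prod>(J - {j}))"
    using cong_dvd_modulus[OF that] same i(1) by (auto simp: of_bool_eq_iff)
  moreover have "\<Prod>J = \<Prod>(J - {j}) * j"
    using j D J by (subst prod.remove[of J j]) auto
  moreover have "coprime (\<Prod>(J - {j})) j"
    using j D J by (intro coprime_prod_Diff[of J]) auto
  ultimately show "strategy_type (Eq s t) (\<Prod>J) e = strategy_type (Eq s t) (\<Prod>(J - {j})) e"
    by (auto simp: cong_mult_coprime_iff)
qed

text \<open>A move in the full product leaves many equal factors by pigeonhole, one of which can be deleted
  instead of \<open>j\<close>, exchanging its role with that of \<open>j\<close> in the answer. A move in the smaller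
  product is extended to the factor \<open>j\<close> by imitating a factor from a large class.\<close>

lemma deletable_Ex:
  assumes "deletable \<phi> K"
  shows "deletable (Ex z \<phi>) (Suc (K * card (types_of \<phi>)))"
  unfolding deletable_def
proof (intro allI impI)
  fix J D :: "int set" and j e
  assume J: "finite J" "pairwise coprime J" and D: "D \<subseteq> J"
    and card: "Suc (K * card (types_of \<phi>)) < card D" and j: "j \<in> D"
    and same: "\<forall>i\<in>D. strategy_type (Ex z \<phi>) i e = strategy_type (Ex z \<phi>) j e"
  have same_type: "strategy_type (Ex z \<phi>) i e = strategy_type (Ex z \<phi>) i' e"
    if "i \<in> D" "i' \<in> D" for i i'
    using same that by (simp del: strategy_type.simps)
  have fin: "finite D"
    using D J finite_subset by blast
  have jJ: "j \<in> J"
    using j D by blast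
  have coprime_j: "coprime (\<Prod>(J - {j})) j"
    using jJ J by (intro coprime_prod_Diff[of J]) auto
  show "strategy_type (Ex z \<phi>) (\<Prod>J) e = strategy_type (Ex z \<phi>) (\<Prod>(J - {j})) e"
  proof (rule strategy_type_Ex_eqI)
    fix a
    obtain D' where D': "D' \<subseteq> D" "K < card D'"
      "\<And>i i'. i \<in> D' \<Longrightarrow> i' \<in> D' \<Longrightarrow> strategy_type \<phi> i (e(z := a)) = strategy_type \<phi> i' (e(z := a))"
      using pigeonhole_types[OF fin Suc_lessD[OF card]] by metis
    obtain i where i: "i \<in> D'"
      using D'(2) by (metis card.empty equals0I less_zeroE)
    have delete_i: "strategy_type \<phi> (\<Prod>J) (e(z := a)) = strategy_type \<phi> (\<Prod>(J - {i})) (e(z := a))"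
      by (rule deletableD[OF assms J _ D'(2) i D'(3)[OF _ i]]) (use D' D in auto)
    show "\<exists>b. strategy_type \<phi> (\<Prod>J) (e(z := a)) = strategy_type \<phi> (\<Prod>(J - {j})) (e(z := b))"
    proof (cases "i = j")
      case True
      then show ?thesis
        using delete_i by blast
    next
      case False
      \<comment> \<open>The product without \<open>i\<close> is \<open>k * j\<close> and the one
        without \<open>j\<close> is \<open>k * i\<close>. The answer \<open>b\<close> keeps
        \<open>a\<close> on the common part \<open>k\<close> and plays on \<open>i\<close> what
        answers \<open>a\<close> on \<open>j\<close>.\<close>
      define k where "k = \<Prod>(J - {i, j})"
      have iJ: "i \<in> J"
        using i D' D by blast
      have "J - {i} - {j} = J - {i, j}" "J - {j} - {i} = J - {i, j}"
        by auto
      then have k: "\<Prod>(J - {i}) = k * j" "\<Prod>(J - {j}) = k * i"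
        using False iJ jJ J(1) prod.remove[of "J - {i}" j "\<lambda>x. x"] prod.remove[of "J - {j}" i "\<lambda>x. x"]
        by (simp_all add: k_def mult.commute)
      have coprime: "coprime k j" "coprime k i"
        unfolding k_def using iJ jJ J by (auto intro: coprime_prod_Diff[of J])
      obtain c where c: "strategy_type \<phi> j (e(z := a)) = strategy_type \<phi> i (e(z := c))"
      proof (rule strategy_type_Ex_eqE)
      show "strategy_type (Ex z \<phi>) j e = strategy_type (Ex z \<phi>) i e"
        by (rule same_type) (use i D' j in auto)
    qed
      obtain b where b: "[b = a] (mod k)" "[b = c] (mod i)"
        using binary_chinese_remainder_int[OF coprime(2)] by blast
      have "strategy_type \<phi> (k * j) (e(z := a)) = strategy_type \<phi> (k * i) (e(z := b))"
        by (rule strategy_type_mult[OF coprime])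
          (simp_all add: c strategy_type_update_cong[OF b(1)] strategy_type_update_cong[OF b(2)])
      then show ?thesis
        using delete_i k by auto
    qed
  next
    fix b
    \<comment> \<open>The \<open>Suc\<close> in the threshold pays for removing \<open>j\<close>:
      the move \<open>b\<close> is made in the product without \<open>j\<close>, so the class is
      sought among the remaining factors.\<close>
    have "K * card (types_of \<phi>) < card (D - {j})"
      using card j fin by simp
    then obtain D' where D': "D' \<subseteq> D - {j}" "K < card D'"
      "\<And>i i'. i \<in> D' \<Longrightarrow> i' \<in> D' \<Longrightarrow> strategy_type \<phi> i (e(z := b)) = strategy_type \<phi> i' (e(z := b))"
      using pigeonhole_types[of "D - {j}" K \<phi>] fin by (metis finite_Diff)
    obtain i where i: "i \<in> D'"
      using D'(2) by (metis card.empty equals0I less_zeroE)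
    obtain c where c: "strategy_type \<phi> i (e(z := b)) = strategy_type \<phi> j (e(z := c))"
    proof (rule strategy_type_Ex_eqE)
      show "strategy_type (Ex z \<phi>) i e = strategy_type (Ex z \<phi>) j e"
        by (rule same_type) (use i D' j in auto)
    qed
    obtain a where a: "[a = b] (mod \<Prod>(J - {j}))" "[a = c] (mod j)"
      using binary_chinese_remainder_int[OF coprime_j] by blast
    \<comment> \<open>\<open>a\<close> agrees with \<open>b\<close> on all factors but
      \<open>j\<close>, so \<open>D'\<close> stays a class, and its residue \<open>c\<close> on
      \<open>j\<close> was chosen to put \<open>j\<close> into that class.\<close>
    have D'_a: "strategy_type \<phi> i' (e(z := a)) = strategy_type \<phi> j (e(z := a))" if "i' \<in> D'" for i'
    proof -
      have "i' dvd \<Prod>(J - {j})"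
        using that D'(1) D J by (intro dvd_prodI[of _ _ "\<lambda>x. x"]) auto
      then have "[a = b] (mod i')"
        using a(1) cong_dvd_modulus by blast
      then show ?thesis
        using D'(3)[OF that i] c
        by (simp add: strategy_type_update_cong strategy_type_update_cong[OF a(2)])
    qed
    have "strategy_type \<phi> (\<Prod>J) (e(z := a)) = strategy_type \<phi> (\<Prod>(J - {j})) (e(z := a))"
    proof (rule deletableD[OF assms J])
      show "insert j D' \<subseteq> J"
        using D' D jJ by blast
      show "K < card (insert j D')"
        using D'(2) card_insert_le by (rule less_le_trans)
    qed (use D'_a in auto)
    also have "\<dots> = strategy_type \<phi> (\<Prod>(J - {j})) (e(z := b))"
      by (rule strategy_type_update_cong[OF a(1)])
    finally show "\<exists>a. strategy_type \<phi> (\<Prod>J) (e(z := a)) = strategy_type \<phi> (\<Prod>(J - {j})) (e(z := b))" ..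
  qed
qed

text \<open>The threshold depends on the formula alone, so the number of factors can be chosen after
  it. A conjunction takes the larger of two thresholds; the constant dummy type settles
  \<open>ExMod\<close>.\<close>

lemma ex_deletable: "\<exists>K. deletable \<phi> K"
proof (induction \<phi> rule: strategy_induct)
  case (Eq s t)
  show ?case
    using deletable_Eq ..
next
  case (Conj \<phi> \<psi>)
  then obtain K where "deletable \<phi> K" "deletable \<psi> K"
    by (metis deletable_mono max.cobounded1 max.cobounded2)
  then have "deletable (Conj \<phi> \<psi>) K"
    unfolding deletable_def strategy_type.simps prod_encode_eq prod.inject by blast
  then show ?case ..
next
  case (Ex z \<phi>)
  then show ?case
    using deletable_Ex by blast
next
  case (ExMod r d z \<phi>)
  show ?case
    by (simp add: deletable_def)
next
  case (equal \<phi> \<psi>)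
  then show ?case
    by (simp add: deletable_def)
qed

section \<open>From strategy types to truth\<close>

lemma tm_val_residue_ring:
  assumes "range e \<subseteq> {0..<m}"
  shows "tm_val (residue_ring m) e t = int_val e t mod m"
proof (induction t)
  case (Var n)
  then show ?case
    using assms by (auto simp: subset_iff)
qed (simp_all add: residue_ring_def mod_simps)

lemma carrier_residue_ring: "carrier (residue_ring m) = {0..<m}"
  by (auto simp: residue_ring_def)

text \<open>The induction hypothesis is a premise here so that the argument serves
  \<open>Ex z \<phi>\<close> directly and \<open>All z \<phi>\<close> by way of
  \<open>Neg \<phi>\<close>.\<close>

lemma sat_Ex_eq_of_strategy_type_eq:
  assumes IH: "\<And>m m' e e'. range e \<subseteq> {0..<m} \<Longrightarrow> range e' \<subseteq> {0..<m'} \<Longrightarrow>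
      strategy_type \<phi> m e = strategy_type \<phi> m' e' \<Longrightarrow>
      sat (residue_ring m) e \<phi> \<longleftrightarrow> sat (residue_ring m') e' \<phi>"
    and range: "range e \<subseteq> {0..<m}" "range e' \<subseteq> {0..<m'}"
    and same: "strategy_type (Ex z \<phi>) m e = strategy_type (Ex z \<phi>) m' e'"
  shows "sat (residue_ring m) e (Ex z \<phi>) \<longleftrightarrow> sat (residue_ring m') e' (Ex z \<phi>)"
proof -
  have move: "sat (residue_ring m') e' (Ex z \<phi>)"
    if range: "range e \<subseteq> {0..<m}" "range e' \<subseteq> {0..<m'}"
      and same: "strategy_type (Ex z \<phi>) m e = strategy_type (Ex z \<phi>) m' e'"
      and sat: "sat (residue_ring m) e (Ex z \<phi>)" for m m' e e'
  proof -
    obtain a where a: "a \<in> {0..<m}" "sat (residue_ring m) (e(z := a)) \<phi>"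
      using sat by (auto simp: carrier_residue_ring)
    obtain b where b: "strategy_type \<phi> m (e(z := a)) = strategy_type \<phi> m' (e'(z := b))"
      by (rule strategy_type_Ex_eqE[OF same])
    \<comment> \<open>A value of \<open>e'\<close> witnesses \<open>m' > 0\<close>, so the integer
      answer \<open>b\<close> can be reduced into the carrier.\<close>
    have "e' 0 \<in> {0..<m'}"
      using range(2) by blast
    then have b_mod: "b mod m' \<in> {0..<m'}"
      by simp
    have "sat (residue_ring m) (e(z := a)) \<phi> \<longleftrightarrow> sat (residue_ring m') (e'(z := b mod m')) \<phi>"
    proof (rule IH)
      show "strategy_type \<phi> m (e(z := a)) = strategy_type \<phi> m' (e'(z := b mod m'))"
        unfolding b by (rule strategy_type_update_cong) (simp add: cong_def)
      show "range (e(z := a)) \<subseteq> {0..<m}" "range (e'(z := b mod m')) \<subseteq> {0..<m'}"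
        using range a(1) b_mod by (simp_all only: image_subset_iff fun_upd_apply) auto
    qed
    then show ?thesis
      using a(2) b_mod by (auto simp: carrier_residue_ring)
  qed
  show ?thesis
    using move[OF range same] move[OF range(2,1) same[symmetric]] by blast
qed

text \<open>Types determine truth only without modular quantifiers, whose type is a dummy; hence the
  restriction to \<open>Ring_formulas\<close>.\<close>

lemma sat_eq_of_strategy_type_eq:
  assumes "\<phi> \<in> Ring_formulas" "range e \<subseteq> {0..<m}" "range e' \<subseteq> {0..<m'}"
    and "strategy_type \<phi> m e = strategy_type \<phi> m' e'"
  shows "sat (residue_ring m) e \<phi> \<longleftrightarrow> sat (residue_ring m') e' \<phi>"
  using assms
proof (induction arbitrary: m m' e e' rule: Ring_formulas.induct)
  case (1 s t)
  then show ?case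
    by (simp add: tm_val_residue_ring cong_def of_bool_eq_iff)
next
  case (2 \<phi>)
  show ?case
    using "2.IH"[OF "2.prems"(1,2)] "2.prems"(3) by simp
next
  case (3 \<phi> \<psi>)
  show ?case
    using "3.IH"(1)[OF "3.prems"(1,2)] "3.IH"(2)[OF "3.prems"(1,2)] "3.prems"(3) by simp
next
  case (4 \<phi> \<psi>)
  show ?case
    using "4.IH"(1)[OF "4.prems"(1,2)] "4.IH"(2)[OF "4.prems"(1,2)] "4.prems"(3) by simp
next
  case (5 \<phi> z)
  show ?case
    using "5.IH" "5.prems" by (rule sat_Ex_eq_of_strategy_type_eq)
next
  case (6 \<phi> z)
  \<comment> \<open>\<open>All z \<phi>\<close> is the negation of \<open>Ex z (Neg \<phi>)\<close>,
    and both have the same strategy type.\<close>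
  have "sat (residue_ring m) e (Ex z (Neg \<phi>)) \<longleftrightarrow> sat (residue_ring m') e' (Ex z (Neg \<phi>))"
  proof (rule sat_Ex_eq_of_strategy_type_eq)
    show "strategy_type (Ex z (Neg \<phi>)) m e = strategy_type (Ex z (Neg \<phi>)) m' e'"
      using "6.prems"(3) by simp
  next
    fix m m' e e'
    assume "range e \<subseteq> {0..<m}" "range e' \<subseteq> {0..<m'}"
      "strategy_type (Neg \<phi>) m e = strategy_type (Neg \<phi>) m' e'"
    then show "sat (residue_ring m) e (Neg \<phi>) \<longleftrightarrow> sat (residue_ring m') e' (Neg \<phi>)"
      using "6.IH"[of e m e' m'] by simp
  qed (use "6.prems" in auto)
  then show ?case
    unfolding sat.simps by blast
qed

section \<open>Truth of sentences and the size of the carrier\<close>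

lemma tm_val_cong_vars:
  assumes "\<And>n. n \<in> tm_vars t \<Longrightarrow> e n = e' n"
  shows "tm_val R e t = tm_val R e' t"
  using assms by (induction t) auto

lemma sat_cong_free_vars:
  assumes "\<And>n. n \<in> free_vars \<phi> \<Longrightarrow> e n = e' n"
  shows "sat R e \<phi> \<longleftrightarrow> sat R e' \<phi>"
  using assms
proof (induction \<phi> arbitrary: e e')
  case (Eq s t)
  then have "tm_val R e s = tm_val R e' s" "tm_val R e t = tm_val R e' t"
    by (auto intro: tm_val_cong_vars)
  then show ?case
    by simp
next
  case (Neg \<phi>)
  show ?case
    using Neg.IH[of e e'] Neg.prems by simp
next
  case (Conj \<phi> \<psi>)
  show ?case
    using Conj.IH[of e e'] Conj.prems by simp
next
  case (Disj \<phi> \<psi>)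
  show ?case
    using Disj.IH[of e e'] Disj.prems by simp
next
  case (Ex z \<phi>)
  have "sat R (e(z := a)) \<phi> \<longleftrightarrow> sat R (e'(z := a)) \<phi>" for a
    by (rule Ex.IH) (use Ex.prems in auto)
  then show ?case
    by simp
next
  case (All z \<phi>)
  have "sat R (e(z := a)) \<phi> \<longleftrightarrow> sat R (e'(z := a)) \<phi>" for a
    by (rule All.IH) (use All.prems in auto)
  then show ?case
    by simp
next
  case (ExMod r d z \<phi>)
  have "sat R (e(z := a)) \<phi> \<longleftrightarrow> sat R (e'(z := a)) \<phi>" for a
    by (rule ExMod.IH) (use ExMod.prems in auto)
  then show ?case
    by simp
qed

lemma models_sentence_iff:
  assumes "free_vars \<phi> = {}" "range e \<subseteq> carrier R"
  shows "R \<TTurnstile> \<phi> \<longleftrightarrow> sat R e \<phi>"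
proof -
  have "sat R e' \<phi> \<longleftrightarrow> sat R e \<phi>" for e'
    by (rule sat_cong_free_vars) (simp add: assms(1))
  then show ?thesis
    using assms(2) unfolding models_def by blast
qed

text \<open>\<open>Eq t t\<close> always holds, so the quantifier counts the whole carrier.
  Nonemptiness supplies an environment; otherwise the left side would be vacuously true.\<close>

lemma models_card_carrier:
  assumes "carrier R \<noteq> {}"
  shows "R \<TTurnstile> ExMod r d z (Eq t t) \<longleftrightarrow> [card (carrier R) = r] (mod d)"
proof -
  obtain x where "x \<in> carrier R"
    using assms by blast
  then have "\<exists>e :: nat \<Rightarrow> _. range e \<subseteq> carrier R"
    by (intro exI[of _ "\<lambda>_. x"]) auto
  then show ?thesis
    by (simp add: models_def)
qed

lemma Ring_formulas_subset_Ring_MOD_formulas: "Ring_formulas \<subseteq> Ring_MOD_formulas d"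
proof
  show "\<phi> \<in> Ring_MOD_formulas d" if "\<phi> \<in> Ring_formulas" for \<phi>
    using that by induction (auto intro: Ring_MOD_formulas.intros)
qed

section \<open>Coprime moduli congruent to -1\<close>

text \<open>Euclid's construction: \<open>P n\<close> is the product of the terms before
  \<open>a n\<close>, and \<open>a n = d * P n - 1\<close> is coprime to it and congruent to
  -1.\<close>

lemma infinite_pairwise_coprime_cong_minus_1:
  assumes "d > 2"
  obtains A :: "int set" where "infinite A" "pairwise coprime A"
    "\<And>a. a \<in> A \<Longrightarrow> a > 0 \<and> [a = -1] (mod d)"
proof -
  define P where "P = rec_nat (1 :: int) (\<lambda>_ p. p * (d * p - 1))"
  define a where "a n = d * P n - 1" for n
  have P_simps: "P 0 = 1" "P (Suc n) = P n * a n" for n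
    by (simp_all add: P_def a_def)
  have P: "P n \<ge> 1" for n
  proof (induction n)
    case (Suc n)
    have "a n \<ge> 1"
      using assms mult_mono[of 2 d 1 "P n"] Suc by (simp add: a_def)
    then show ?case
      using Suc mult_mono[of 1 "P n" 1 "a n"] by (simp add: P_simps)
  qed (simp add: P_simps)
  have a: "a n > 1" for n
    using assms mult_mono[of 3 d 1 "P n"] P[of n] by (simp add: a_def)
  have dvd: "a k dvd P n" if "k < n" for k n
    using that by (induction n) (auto simp: P_simps less_Suc_eq)
  have coprime_P: "coprime (P n) (a n)" for n
  proof (rule coprimeI)
    fix c assume "c dvd P n" "c dvd a n"
    then have "c dvd d * P n - a n"
      by (intro dvd_diff dvd_mult)
    then show "is_unit c"
      by (simp add: a_def)
  qed
  have coprime_less: "coprime (a k) (a n)" if "k < n" for k n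
    by (rule coprime_divisors[OF dvd[OF that] dvd_refl coprime_P])
  have coprime: "coprime (a k) (a n)" if "k \<noteq> n" for k n
    using that coprime_less by (metis coprime_commute nat_neq_iff)
  have "inj a"
  \<comment> \<open>A value taken at two indices would be coprime to itself, hence a unit,
    contradicting \<open>a n > 1\<close>.\<close>
  proof (rule injI, rule ccontr)
    fix k n assume "a k = a n" "k \<noteq> n"
    then show False
      using coprime[of k n] a[of n] by simp
  qed
  show thesis
  proof
    show "infinite (range a)"
      using \<open>inj a\<close> by (simp add: finite_image_iff)
    show "pairwise coprime (range a)"
      using coprime by (auto simp: pairwise_def) metis
    show "x > 0 \<and> [x = -1] (mod d)" if x: "x \<in> range a" for x
    proof -
      obtain n where "x = a n"
        using x by blast
      then show ?thesis
        using a[of n] by (simp add: a_def cong_iff_dvd_diff)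
    qed
  qed
qed

section \<open>The parity argument\<close>

lemma infinite_constant_type_subset:
  assumes "infinite A"
  obtains B where "B \<subseteq> A" "infinite B"
    "\<And>i j. i \<in> B \<Longrightarrow> j \<in> B \<Longrightarrow> strategy_type \<phi> i e = strategy_type \<phi> j e"
proof -
  have "finite ((\<lambda>i. strategy_type \<phi> i e) ` A)"
    by (rule finite_subset[OF _ finite_types_of[of \<phi>]]) auto
  then obtain i where "infinite {j \<in> A. strategy_type \<phi> j e = strategy_type \<phi> i e}"
    using pigeonhole_infinite[OF assms] by blast
  then show thesis
    by (intro that[of "{j \<in> A. strategy_type \<phi> j e = strategy_type \<phi> i e}"]) auto
qed

theorem theorem5p12:
  fixes d :: nat
  assumes "d > 2"
  shows "Ring_sentences \<subseteq> Ring_MOD_sentences d \<and>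
    (\<exists>\<theta> \<in> Ring_MOD_sentences d. \<not> (\<exists>\<sigma> \<in> Ring_sentences.
      \<forall>m::nat. m \<ge> 1 \<longrightarrow> (Zmod m \<TTurnstile> \<sigma> \<longleftrightarrow> Zmod m \<TTurnstile> \<theta>)))"
proof (intro conjI bexI notI)
  show "Ring_sentences \<subseteq> Ring_MOD_sentences d"
    using Ring_formulas_subset_Ring_MOD_formulas
    by (auto simp: Ring_sentences_def Ring_MOD_sentences_def)
  let ?\<theta> = "ExMod 1 d 0 (Eq (Var 0) (Var 0))"
  show "?\<theta> \<in> Ring_MOD_sentences d"
    using assms by (auto simp: Ring_MOD_sentences_def intro!: Ring_MOD_formulas.intros)
  assume "\<exists>\<sigma> \<in> Ring_sentences. \<forall>m::nat. m \<ge> 1 \<longrightarrow> (Zmod m \<TTurnstile> \<sigma> \<longleftrightarrow> Zmod m \<TTurnstile> ?\<theta>)"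
  then obtain \<sigma> where \<sigma>: "\<sigma> \<in> Ring_formulas" "free_vars \<sigma> = {}"
    and equiv: "\<And>m::nat. m \<ge> 1 \<Longrightarrow> (Zmod m \<TTurnstile> \<sigma> \<longleftrightarrow> Zmod m \<TTurnstile> ?\<theta>)"
    by (auto simp: Ring_sentences_def)
  \<comment> \<open>The zero environment lies in every carrier with \<open>m > 0\<close>, so it can
    evaluate a sentence in all the rings.\<close>
  let ?e = "\<lambda>_. 0 :: int"
  have \<sigma>_iff: "sat (residue_ring m) ?e \<sigma> \<longleftrightarrow> [m = 1] (mod int d)" if "m > 0" for m :: int
  proof -
    have m: "m = int (nat m)" "nat m \<ge> 1"
      using that by auto
    have "sat (residue_ring m) ?e \<sigma> \<longleftrightarrow> residue_ring m \<TTurnstile> \<sigma>"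
      using that \<sigma> by (intro models_sentence_iff[symmetric]) (auto simp: carrier_residue_ring)
    also have "\<dots> \<longleftrightarrow> residue_ring m \<TTurnstile> ?\<theta>"
      using equiv[OF m(2)] m(1) by simp
    also have "\<dots> \<longleftrightarrow> [nat m = 1] (mod d)"
      using that by (subst models_card_carrier) (auto simp: carrier_residue_ring)
    also have "\<dots> \<longleftrightarrow> [m = 1] (mod int d)"
      using m(1) cong_int_iff[of "nat m" 1 d] by simp
    finally show ?thesis .
  qed
  obtain A :: "int set" where A: "infinite A" "pairwise coprime A"
    "\<And>a. a \<in> A \<Longrightarrow> a > 0 \<and> [a = -1] (mod int d)"
    using infinite_pairwise_coprime_cong_minus_1[of "int d"] assms by auto
  obtain B where B: "B \<subseteq> A" "infinite B"
    "\<And>i j. i \<in> B \<Longrightarrow> j \<in> B \<Longrightarrow> strategy_type \<sigma> i ?e = strategy_type \<sigma> j ?e"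
    using infinite_constant_type_subset[OF A(1)] by metis
  obtain K where K: "deletable \<sigma> K"
    using ex_deletable by blast
  \<comment> \<open>The size is even, so the full product is 1 mod \<open>d\<close> while deleting
    one factor leaves -1; it also exceeds the threshold \<open>K\<close>.\<close>
  obtain J where J: "finite J" "J \<subseteq> B" "card J = 2 * Suc K"
    using infinite_arbitrarily_large[OF B(2)] by blast
  obtain j where j: "j \<in> J"
    using J(3) by (metis card.empty equals0I mult_is_0 nat.distinct(1) numeral_2_eq_2)
  have pos: "\<Prod>I > 0" and prod_cong: "[\<Prod>I = (-1) ^ card I] (mod int d)" if "I \<subseteq> J" for I
  proof -
    have I: "i > 0 \<and> [i = -1] (mod int d)" if "i \<in> I" for i
      using A(3) B(1) J(2) \<open>I \<subseteq> J\<close> that by blast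
    then show "\<Prod>I > 0"
      by (intro prod_pos) auto
    have "[\<Prod>I = (\<Prod>i\<in>I. -1)] (mod int d)"
      using I by (intro cong_prod) auto
    then show "[\<Prod>I = (-1) ^ card I] (mod int d)"
      by simp
  qed
  have "strategy_type \<sigma> (\<Prod>J) ?e = strategy_type \<sigma> (\<Prod>(J - {j})) ?e"
  \<comment> \<open>All of \<open>J\<close> lies in \<open>B\<close>, so \<open>J\<close> itself is
    the class of equal factors.\<close>
  proof (rule deletableD[OF K J(1) _ subset_refl _ j])
    show "pairwise coprime J"
      using A(2) B(1) J(2) by (meson pairwise_subset)
    show "K < card J"
      using J(3) by simp
    show "strategy_type \<sigma> i ?e = strategy_type \<sigma> j ?e" if "i \<in> J" for i
      using B(3) J(2) j that by blast
  qed
  then have "sat (residue_ring (\<Prod>J)) ?e \<sigma> \<longleftrightarrow> sat (residue_ring (\<Prod>(J - {j}))) ?e \<sigma>"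
    using pos[of J] pos[of "J - {j}"] by (intro sat_eq_of_strategy_type_eq[OF \<sigma>(1)]) auto
  then have "[\<Prod>J = 1] (mod int d) \<longleftrightarrow> [\<Prod>(J - {j}) = 1] (mod int d)"
    using \<sigma>_iff pos[of J] pos[of "J - {j}"] by auto
  moreover have "[\<Prod>J = 1] (mod int d)"
    using prod_cong[of J] J(3) by simp
  moreover have "[\<Prod>(J - {j}) = -1] (mod int d)"
    using prod_cong[of "J - {j}"] J j by (simp add: card_Diff_singleton)
  ultimately have "[1 = -1] (mod int d)"
    by (metis cong_sym cong_trans)
  then have "int d dvd 2"
    by (simp add: cong_iff_dvd_diff)
  then show False
    using assms zdvd_imp_le by fastforce
qed

end
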